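(* Let $n\ge 1$ and let $\pi:W_n\to W_{n-1}$ be the deletion map erasing the letter $\pm n$. Then the pre-Reeb graph $R(\pi)$ is isomorphic, as a directed graph, to $\Gamma(F_n)$. In particular, $R(\pi)$ is acyclic (so that $\mathsf{Reeb}(\pi)$ is defined as the reachability poset of $R(\pi)$).
   Context: $[m]=\{1,\dots,m\}$. $W_n$ is the hyperoctahedral group, written as words in the letters $\{\pm1,\dots,\pm n\}$ using each absolute value exactly once ($W_0$ consists of the empty word). With the signed order $-n<\cdots<-1<1<\cdots<n$, the (right) weak order on $W_n$ is the poset whose covers $u\to v$ are: (1) adjacent swaps $\cdots a\,b\cdots\mapsto\cdots b\,a\cdots$ whenever $a<b$ in the signed order; (2) the sign flip of the first letter $a_1\mapsto -a_1$ whenever $a_1>0$. The map $\pi:W_n\to W_{n-1}$ deletes the letter of absolute value $n$. For every cover $v\to w$ in $W_n$, either $\pi(v)=\pi(w)$ (vertical cover) or $\pi(v)\to\pi(w)$ is a cover in $W_{n-1}$ (horizontal cover). Let $\sim_h$ be the equivalence relation on $W_n$ generated by $v\sim_h w$ for horizontal covers $v\to w$; $[v]$ denotes the class of $v$. The pre-Reeb graph $R(\pi)$ is the directed graph whose vertices are the $\sim_h$-classes, with an edge $[v]\to[w]$ whenever there are $v'\in[v]$, $w'\in[w]$ such that $v'\to w'$ is a vertical cover. The reachability poset of an acyclic directed graph is its vertex set with $x\le y$ iff there is a directed path from $x$ to $y$. $F_n$ is the undirected graph with vertex set $\{L,R\}\sqcup[n-1]$ and edge set $\{LR\}\sqcup\{Li: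 i\in[n-1]\}\sqcup\{iR: i\in[n-1]\}$. $\mathsf{AO}(F_n)$ is the set of acyclic orientations of $F_n$, and $\mathcal O_0$ is the orientation $L\to R$, $L\to i$, $i\to R$ ($i\in[n-1]$). $\Gamma(F_n)$ is the directed graph with vertex set $\mathsf{AO}(F_n)$ and with a directed edge $\mathcal O\to\mathcal O'$ whenever $\mathcal O'$ is obtained from $\mathcal O$ by reversing exactly one edge of $F_n$, that edge being directed in $\mathcal O$ as in $\mathcal O_0$. *)

theory Defs
  imports "Graph_Theory.Graph_Theory"
begin

definition W :: "nat \<Rightarrow> int list set" where
  "W n = {w. distinct (map abs w) \<and> abs ` set w = {1..int n}}"

inductive cover_step :: "int list \<Rightarrow> int list \<Rightarrow> bool" where
  swap: "a < b \<Longrightarrow> cover_step (u @ [a, b] @ v) (u @ [b, a] @ v)"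
| flip: "a > 0 \<Longrightarrow> cover_step (a # v) ((- a) # v)"

definition weak_cover :: "nat \<Rightarrow> int list \<Rightarrow> int list \<Rightarrow> bool" where
  "weak_cover n v w \<longleftrightarrow> v \<in> W n \<and> w \<in> W n \<and> cover_step v w"

definition delete_letter :: "nat \<Rightarrow> int list \<Rightarrow> int list" where
  "delete_letter n w = filter (\<lambda>a. \<bar>a\<bar> \<noteq> int n) w"

definition vertical_cover :: "nat \<Rightarrow> int list \<Rightarrow> int list \<Rightarrow> bool" where
  "vertical_cover n v w \<longleftrightarrow> weak_cover n v w \<and> delete_letter n v = delete_letter n w"

definition horizontal_cover :: "nat \<Rightarrow> int list \<Rightarrow> int list \<Rightarrow> bool" where
  "horizontal_cover n v w \<longleftrightarrow>
     weak_cover n v w \<and> weak_cover (n - 1) (delete_letter n v) (delete_letter n w)"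

definition sim_h :: "nat \<Rightarrow> int list rel" where
  "sim_h n = {(v, w). v \<in> W n \<and> w \<in> W n \<and> equivclp (horizontal_cover n) v w}"

text \<open>
  Loops are not excluded below: an arc from a class to itself would arise from a vertical cover
  between horizontally equivalent words.
\<close>

definition pre_Reeb :: "nat \<Rightarrow> int list set pair_pre_digraph" where
  "pre_Reeb n =
     \<lparr> pverts = W n // sim_h n,
       parcs = {(C, D). C \<in> W n // sim_h n \<and> D \<in> W n // sim_h n \<and>
                  (\<exists>v\<in>C. \<exists>w\<in>D. vertical_cover n v w)} \<rparr>"

definition reachability_rel :: "('a, 'b) pre_digraph \<Rightarrow> 'a rel" where
  "reachability_rel G = {(x, y). x \<rightarrow>\<^sup>*\<^bsub>G\<^esub> y}"

text \<open>
  An undirected simple graph is a pair of a vertex set and a set of two-element vertex sets.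
  An orientation is encoded by its set of arcs, \<open>(x, y)\<close> standing for \<open>x \<rightarrow> y\<close>.
\<close>

type_synonym 'a ugraph = "'a set \<times> 'a set set"

definition orientations :: "'a ugraph \<Rightarrow> 'a rel set" where
  "orientations G = {A. A \<subseteq> fst G \<times> fst G \<and> (\<forall>(x, y)\<in>A. {x, y} \<in> snd G) \<and>
     (\<forall>x y. {x, y} \<in> snd G \<longrightarrow> ((x, y) \<in> A \<longleftrightarrow> (y, x) \<notin> A))}"

definition AO :: "'a ugraph \<Rightarrow> 'a rel set" where
  "AO G = {A \<in> orientations G. acyclic A}"

definition AO_flip_graph :: "'a ugraph \<Rightarrow> 'a rel \<Rightarrow> 'a rel pair_pre_digraph" where
  "AO_flip_graph G A0 =
     \<lparr> pverts = AO G,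
       parcs = {(A, B). A \<in> AO G \<and> B \<in> AO G \<and>
                  (\<exists>x y. (x, y) \<in> A \<and> (x, y) \<in> A0 \<and> B = insert (y, x) (A - {(x, y)}))} \<rparr>"

datatype fan_vertex = VL | VR | Mid nat

definition fan_graph :: "nat \<Rightarrow> fan_vertex ugraph" where
  "fan_graph n =
     ({VL, VR} \<union> Mid ` {1..n - 1},
      {{VL, VR}} \<union> {{VL, Mid i} |i. i \<in> {1..n - 1}} \<union> {{Mid i, VR} |i. i \<in> {1..n - 1}})"

definition fan_base :: "nat \<Rightarrow> fan_vertex rel" where
  "fan_base n =
     {(VL, VR)} \<union> {(VL, Mid i) |i. i \<in> {1..n - 1}} \<union> {(Mid i, VR) |i. i \<in> {1..n - 1}}"

definition Gamma_fan :: "nat \<Rightarrow> fan_vertex rel pair_pre_digraph" where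
  "Gamma_fan n = AO_flip_graph (fan_graph n) (fan_base n)"

end

theory Submission
  imports Defs "HOL-Library.Multiset"
begin

text \<open>
  Write a word of \<open>W n\<close> as \<open>u e v\<close> with \<open>e = \<plusminus>n\<close>. A cover that does not involve \<open>e\<close> is horizontal: it
  swaps two letters inside \<open>u\<close>, swaps two letters inside \<open>v\<close>, or flips the first letter of a nonempty
  \<open>u\<close>. None of these changes \<open>e\<close> or the set \<open>S\<close> of signed letters of \<open>v\<close>. Conversely, since the
  relation generated by horizontal covers is symmetric, it permutes \<open>v\<close> and \<open>u\<close> freely, and any letter
  of \<open>u\<close> can travel to the front, change its sign and travel back. So \<open>(e, S)\<close> is a complete invariant
  of the horizontal class (\<open>sim_h_iff_config\<close>); call it the configuration of the word. A vertical cover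
  moves \<open>e\<close>: the letter \<open>n\<close> moves left and \<open>S\<close> gains an element, or \<open>n\<close> stands in front and becomes
  \<open>-n\<close>, or \<open>-n\<close> moves right and \<open>S\<close> loses an element. Every such step between configurations comes
  from a vertical cover (\<open>vertical_cover_config_step\<close>, \<open>config_step_lift\<close>), so the pre-Reeb graph is
  the graph of configurations and steps.

  Configurations are also acyclic orientations of the fan. Consider the doubled word, the negated
  reversal of \<open>u e v\<close> followed by \<open>u e v\<close> itself, whose letters are \<open>\<plusminus>1, \<dots>, \<plusminus>n\<close>. Name \<open>VL\<close> by \<open>-n\<close>,
  \<open>VR\<close> by \<open>n\<close> and \<open>Mid i\<close> by \<open>i\<close>, and orient each edge of the fan from the earlier to the later
  letter. The result is acyclic and depends only on \<open>(e, S)\<close>. Each triangle \<open>VL, VR, Mid i\<close> has, once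
  the edge between \<open>VL\<close> and \<open>VR\<close> is oriented, three acyclic orientations, which correspond to
  \<open>i \<in> S\<close>, \<open>-i \<in> S\<close> and neither; hence the correspondence is bijective (\<open>orient_bij\<close>). The three kinds
  of steps reverse an edge between \<open>Mid i\<close> and \<open>VR\<close> or \<open>VL\<close>, or the edge \<open>VL VR\<close>, each time starting
  from its direction in the base orientation, and no other reversal of a base arc stays acyclic
  (\<open>config_step_fan_flip\<close>, \<open>fan_flip_config_step\<close>).

  Acyclicity of the pre-Reeb graph follows from a rank on configurations: the size of \<open>S\<close> grows until
  \<open>n\<close> turns into \<open>-n\<close> and shrinks afterwards. Reachability in an acyclic digraph is a partial order.
\<close>

section \<open>Configurations of words\<close>

definition signed_subsets :: "nat \<Rightarrow> int set set" where
  "signed_subsets m = {S. abs ` S \<subseteq> {1..int m} \<and> (\<forall>c\<in>S. - c \<notin> S)}"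

definition configs :: "nat \<Rightarrow> (int \<times> int set) set" where
  "configs n = {(e, S). \<bar>e\<bar> = int n \<and> S \<in> signed_subsets (n - 1)}"

text \<open>
  The effect on configurations of moving the letter of absolute value \<open>n\<close> up in the weak order while
  the other letters keep their order. In \<open>pass_up\<close> and \<open>pass_down\<close>, the letter \<open>c\<close> is the one
  exchanged with \<open>\<plusminus>n\<close>; it may carry either sign because the sign of a letter in front of \<open>\<plusminus>n\<close> is
  not recorded. In \<open>turn\<close>, the fullness of \<open>S\<close> says that \<open>n\<close> is the first letter.
\<close>

inductive config_step :: "nat \<Rightarrow> int \<times> int set \<Rightarrow> int \<times> int set \<Rightarrow> bool" for n where
  pass_up: "\<lbrakk>S \<in> signed_subsets (n - 1); \<bar>c\<bar> \<in> {1..int (n - 1)}; c \<notin> S; - c \<notin> S\<rbrakk>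
    \<Longrightarrow> config_step n (int n, S) (int n, insert c S)"
| turn: "\<lbrakk>S \<in> signed_subsets (n - 1); abs ` S = {1..int (n - 1)}\<rbrakk>
    \<Longrightarrow> config_step n (int n, S) (- int n, S)"
| pass_down: "\<lbrakk>S \<in> signed_subsets (n - 1); \<bar>c\<bar> \<in> {1..int (n - 1)}; c \<notin> S; - c \<notin> S\<rbrakk>
    \<Longrightarrow> config_step n (- int n, insert c S) (- int n, S)"

definition config :: "nat \<Rightarrow> int list \<Rightarrow> int \<times> int set" where
  "config n w = (let t = dropWhile (\<lambda>a. \<bar>a\<bar> \<noteq> int n) w in (hd t, set (tl t)))"

lemma config_split:
  assumes "\<bar>e\<bar> = int n" "\<forall>a\<in>set u. \<bar>a\<bar> \<noteq> int n"
  shows "config n (u @ e # v) = (e, set v)"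
  using assms by (simp add: config_def)

lemma W_abs_less:
  assumes "u @ e # v \<in> W n" "\<bar>e\<bar> = int n"
  shows "a \<in> set u \<union> set v \<Longrightarrow> \<bar>a\<bar> \<in> {1..int (n - 1)}"
proof -
  assume a: "a \<in> set u \<union> set v"
  then have "\<bar>a\<bar> \<in> {1..int n}" using assms(1) by (auto simp: W_def)
  moreover have "\<bar>a\<bar> \<noteq> int n" using a assms by (auto simp: W_def image_iff)
  ultimately show ?thesis by auto
qed

lemma W_config_split:
  assumes "u @ e # v \<in> W n" "\<bar>e\<bar> = int n"
  shows "config n (u @ e # v) = (e, set v)"
  using W_abs_less[OF assms] assms by (intro config_split) force+

lemma W_split:
  assumes "w \<in> W n" "n \<ge> 1"
  obtains u e v where "w = u @ e # v" "\<bar>e\<bar> = int n"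
proof -
  have "int n \<in> abs ` set w" using assms by (auto simp: W_def)
  then obtain e where "e \<in> set w" "\<bar>e\<bar> = int n" by auto
  then show ?thesis using that by (meson split_list)
qed

lemma W_distinct: "w \<in> W n \<Longrightarrow> distinct w"
  by (auto simp: W_def distinct_map)

lemma W_nonzero: "w \<in> W n \<Longrightarrow> a \<in> set w \<Longrightarrow> a \<noteq> 0"
  by (force simp: W_def)

lemma signed_subset_suffix:
  assumes "u @ e # v \<in> W n" "\<bar>e\<bar> = int n"
  shows "set v \<in> signed_subsets (n - 1)"
proof -
  have "- c \<notin> set v" if "c \<in> set v" for c
  proof
    assume "- c \<in> set v"
    moreover have "inj_on abs (set v)"
      using assms by (auto simp: W_def distinct_map intro: inj_on_subset)
    ultimately have "c = - c" using that by (metis abs_minus_cancel inj_onD)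
    moreover have "c \<noteq> 0" using that assms by (auto dest: W_nonzero[where a=c])
    ultimately show False by simp
  qed
  then show ?thesis using W_abs_less[OF assms] by (auto simp: signed_subsets_def)
qed

lemma config_in_configs:
  assumes "w \<in> W n" "n \<ge> 1"
  shows "config n w \<in> configs n"
proof -
  obtain u e v where "w = u @ e # v" "\<bar>e\<bar> = int n" using W_split[OF assms] .
  then show ?thesis using assms by (simp add: W_config_split configs_def signed_subset_suffix del: One_nat_def)
qed

text \<open>
  Membership in \<open>W n\<close> ignores order and signs, so one multiset comparison settles it after
  every rearrangement below.
\<close>

lemma W_cong:
  assumes "v \<in> W n" "mset (map abs v) = mset (map abs w)"
  shows "w \<in> W n"
  using assms mset_eq_setD[OF assms(2)] mset_eq_imp_distinct_iff[OF assms(2)] by (auto simp: W_def)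

lemma W_delete_letter:
  assumes "w \<in> W n"
  shows "delete_letter n w \<in> W (n - 1)"
proof -
  have "abs ` set (delete_letter n w) = abs ` set w - {int n}"
    by (auto simp: delete_letter_def)
  also have "\<dots> = {1..int (n - 1)}" using assms by (auto simp: W_def)
  finally show ?thesis using assms by (auto simp: W_def delete_letter_def distinct_map_filter)
qed

section \<open>Horizontal classes\<close>

text \<open>
  Horizontal covers go up in the weak order, but the generated equivalence does not see the
  direction, so the order of \<open>a\<close> and \<open>b\<close> does not matter here, nor the sign of \<open>a\<close> in the next lemma.
\<close>

lemma horizontal_swap:
  assumes "u @ [a, b] @ v \<in> W n" "\<bar>a\<bar> \<noteq> int n" "\<bar>b\<bar> \<noteq> int n"
  shows "equivclp (horizontal_cover n) (u @ [a, b] @ v) (u @ [b, a] @ v)"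
proof -
  have h: "horizontal_cover n (u @ [a, b] @ v) (u @ [b, a] @ v)"
    if "a < b" "u @ [a, b] @ v \<in> W n" "\<bar>a\<bar> \<noteq> int n" "\<bar>b\<bar> \<noteq> int n" for a b
  proof -
    have w: "u @ [b, a] @ v \<in> W n" using that(2) by (rule W_cong) simp
    have "cover_step (delete_letter n (u @ [a, b] @ v)) (delete_letter n (u @ [b, a] @ v))"
      using that cover_step.swap[of a b "delete_letter n u" "delete_letter n v"]
      by (simp add: delete_letter_def)
    then show ?thesis using w that W_delete_letter[OF w] W_delete_letter[OF that(2)]
      by (simp only: horizontal_cover_def weak_cover_def cover_step.swap)
  qed
  have ba: "u @ [b, a] @ v \<in> W n" using assms(1) by (rule W_cong) simp
  show ?thesis
  proof (cases a b rule: linorder_cases)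
    case less
    from h[OF this assms] show ?thesis by blast
  next
    case greater
    from h[OF this ba assms(3,2)] show ?thesis by blast
  qed simp
qed

lemma horizontal_flip:
  assumes "a # v \<in> W n" "\<bar>a\<bar> \<noteq> int n" 
  shows "equivclp (horizontal_cover n) (a # v) (- a # v)"
proof -
  have h: "horizontal_cover n (a # v) (- a # v)" if "a > 0" "a # v \<in> W n" "\<bar>a\<bar> \<noteq> int n" for a
  proof -
    have w: "- a # v \<in> W n" using that(2) by (rule W_cong) simp
    have "cover_step (delete_letter n (a # v)) (delete_letter n (- a # v))"
      using that cover_step.flip[of a "delete_letter n v"] by (simp add: delete_letter_def)
    then show ?thesis using w that W_delete_letter[OF w] W_delete_letter[OF that(2)]
      by (simp only: horizontal_cover_def weak_cover_def cover_step.flip)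
  qed
  have w: "- a # v \<in> W n" using assms(1) by (rule W_cong) simp
  have "a \<noteq> 0" using assms(1) by (auto dest: W_nonzero)
  then consider "a > 0" | "- a > 0" by linarith
  then show ?thesis
  proof cases
    case 1
    from h[OF this assms] show ?thesis by blast
  next
    case 2
    from h[OF this w] assms(2) show ?thesis by (simp add: r_into_equivclp converse_r_into_equivclp)
  qed
qed

text \<open>
  Repeated adjacent swaps carry \<open>a\<close> leftwards across a block that avoids \<open>\<plusminus>n\<close>.
\<close>

lemma horizontal_front:
  assumes "x @ s @ a # y \<in> W n" "\<forall>c\<in>insert a (set s). \<bar>c\<bar> \<noteq> int n"
  shows "equivclp (horizontal_cover n) (x @ s @ a # y) (x @ a # s @ y)"
  using assms
proof (induction s arbitrary: y rule: rev_induct)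
  case (snoc b s)
  have "equivclp (horizontal_cover n) (x @ (s @ [b]) @ a # y) (x @ s @ a # b # y)"
    using horizontal_swap[of "x @ s" b a y n] snoc.prems by simp
  moreover have "x @ s @ a # b # y \<in> W n" using snoc.prems(1) by (rule W_cong) simp
  then have "equivclp (horizontal_cover n) (x @ s @ a # b # y) (x @ a # s @ b # y)"
    using snoc.IH[of "b # y"] snoc.prems by simp
  ultimately show ?case by (auto intro: equivclp_trans)
qed simp

text \<open>
  Selection sort: bring the first letter of the target block to the front of the block and continue
  with the remaining letters.
\<close>

lemma horizontal_permute:
  assumes "x @ s @ y \<in> W n" "\<forall>c\<in>set s. \<bar>c\<bar> \<noteq> int n" "mset s = mset t"
  shows "equivclp (horizontal_cover n) (x @ s @ y) (x @ t @ y)"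
  using assms
proof (induction t arbitrary: s x)
  case (Cons a t)
  have "a \<in> set s" using Cons.prems(3) by (metis list.set_intros(1) set_mset_mset)
  then obtain s1 s2 where s: "s = s1 @ a # s2" by (meson split_list)
  have "equivclp (horizontal_cover n) (x @ s1 @ a # (s2 @ y)) (x @ a # s1 @ (s2 @ y))"
    using Cons.prems s by (intro horizontal_front) auto
  moreover have "x @ a # s1 @ s2 @ y \<in> W n" using Cons.prems(1) by (rule W_cong) (simp add: s)
  then have "equivclp (horizontal_cover n) ((x @ [a]) @ (s1 @ s2) @ y) ((x @ [a]) @ t @ y)"
    using Cons.prems s by (intro Cons.IH) auto
  ultimately show ?case by (auto simp: s intro: equivclp_trans)
qed simp

text \<open>
  A letter of an initial block can be moved to the front, flipped there, and moved back. This is why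
  the signs of the letters before \<open>\<plusminus>n\<close> carry no information.
\<close>

lemma horizontal_make_positive:
  assumes "s @ y \<in> W n" "\<forall>c\<in>set s. \<bar>c\<bar> \<noteq> int n"
  shows "equivclp (horizontal_cover n) (s @ y) (map abs s @ y)"
  using assms
proof (induction s arbitrary: y rule: rev_induct)
  case (snoc a s)
  have front: "equivclp (horizontal_cover n) (s @ a # y) (a # s @ y)"
    using horizontal_front[of "[]" s a y n] snoc.prems by simp
  have w1: "a # s @ y \<in> W n" using snoc.prems(1) by (rule W_cong) simp
  have flip: "equivclp (horizontal_cover n) (a # s @ y) (\<bar>a\<bar> # s @ y)"
    using horizontal_flip[OF w1] snoc.prems by (cases "a \<ge> 0") auto
  have w2: "s @ \<bar>a\<bar> # y \<in> W n" using snoc.prems(1) by (rule W_cong) simp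
  have move_back: "equivclp (horizontal_cover n) (s @ \<bar>a\<bar> # y) (\<bar>a\<bar> # s @ y)"
    using horizontal_front[of "[]" s "\<bar>a\<bar>" y n] w2 snoc.prems by simp
  have rest: "equivclp (horizontal_cover n) (s @ \<bar>a\<bar> # y) (map abs s @ \<bar>a\<bar> # y)"
    using snoc.IH w2 snoc.prems by simp
  from front flip equivclp_sym[OF move_back] rest show ?case by simp (meson equivclp_trans)
qed simp

text \<open>
  Completeness of the configuration as an invariant: sort the suffix into the common order, make the
  prefix positive, and then sort the prefix; its absolute values are those missing from the
  suffix.
\<close>

lemma sim_h_if_config_eq:
  assumes "w \<in> W n" "w' \<in> W n" "n \<ge> 1" "config n w = config n w'"
  shows "(w, w') \<in> sim_h n"
proof -
  obtain u e v where w: "w = u @ e # v" "\<bar>e\<bar> = int n" using W_split[OF assms(1,3)] .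
  obtain u' e' v' where w': "w' = u' @ e' # v'" "\<bar>e'\<bar> = int n" using W_split[OF assms(2,3)] .
  have e: "e' = e" and v: "set v = set v'"
    using assms(4) W_config_split assms(1,2) w w' by auto
  have small: "\<bar>a\<bar> \<noteq> int n" if "a \<in> set u \<union> set v \<union> set u' \<union> set v'" for a
    using W_abs_less[of u e v n a] W_abs_less[of u' e' v' n a] that w w' assms by auto
  have "mset v = mset v'" using v W_distinct[OF assms(1)] W_distinct[OF assms(2)] w w'
    by (simp add: set_eq_iff_mset_eq_distinct)
  then have 1: "equivclp (horizontal_cover n) (u @ e # v) (u @ e # v')"
    using horizontal_permute[of "u @ [e]" v "[]" n v'] assms(1) w small by simp
  have W1: "u @ e # v' \<in> W n" using assms(1)
    by (rule W_cong) (simp add: w \<open>mset v = mset v'\<close>)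
  have "abs ` set u = {1..int n} - {int n} - abs ` set v'"
    using W1 w small unfolding W_def by auto
  moreover have "abs ` set u' = {1..int n} - {int n} - abs ` set v'"
    using assms(2) w' v small unfolding W_def by auto
  ultimately have "set (map abs u) = set (map abs u')" by simp
  moreover have "distinct (map abs u)" "distinct (map abs u')"
    using assms(2) W1 w' by (auto simp: W_def)
  ultimately have ms: "mset (map abs u) = mset (map abs u')"
    by (metis set_eq_iff_mset_eq_distinct)
  have 2: "equivclp (horizontal_cover n) (u @ e # v') (map abs u @ e # v')"
    using horizontal_make_positive[OF W1] small by simp
  have W2: "map abs u @ e # v' \<in> W n" using W1 by (rule W_cong) (simp add: o_def)
  have 3: "equivclp (horizontal_cover n) (map abs u @ e # v') (map abs u' @ e # v')"
    using horizontal_permute[of "[]" "map abs u" "e # v'" n "map abs u'"] W2 ms small by simp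
  have 4: "equivclp (horizontal_cover n) (u' @ e # v') (map abs u' @ e # v')"
    using horizontal_make_positive[of u' "e # v'" n] assms(2) w' e small by simp
  from 1 2 3 equivclp_sym[OF 4] have "equivclp (horizontal_cover n) w w'"
    unfolding w w' e by (meson equivclp_trans)
  then show ?thesis using assms by (simp add: sim_h_def)
qed

lemma cover_step_neq: "cover_step v w \<Longrightarrow> v \<noteq> w"
  by (induction rule: cover_step.induct) auto

text \<open>
  A cover whose two ends have different deletions cannot involve \<open>\<plusminus>n\<close>, and then it acts within the
  prefix or within the suffix.
\<close>

lemma horizontal_cover_config:
  assumes "horizontal_cover n v w" "n \<ge> 1"
  shows "config n v = config n w"
proof -
  have vW: "v \<in> W n" "w \<in> W n" "cover_step v w"
    and ne: "delete_letter n v \<noteq> delete_letter n w"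
    using assms cover_step_neq by (auto simp: horizontal_cover_def weak_cover_def)
  from vW(3,1,2) ne show ?thesis
  proof cases
    case (swap a b x y)
    have "\<bar>a\<bar> \<noteq> \<bar>b\<bar>" using vW(1) swap by (auto simp: W_def)
    then have ab: "\<bar>a\<bar> \<noteq> int n" "\<bar>b\<bar> \<noteq> int n"
      using ne \<open>\<bar>a\<bar> \<noteq> \<bar>b\<bar>\<close> unfolding swap(1,2) delete_letter_def by auto
    then show ?thesis unfolding swap config_def
      by (induction x) (auto simp: Let_def dropWhile_append insert_commute)
  next
    case (flip a y)
    have "\<bar>a\<bar> \<noteq> int n"
      using ne unfolding flip by (auto simp: delete_letter_def)
    then show ?thesis unfolding flip config_def by simp
  qed
qed

lemma sim_h_iff_config:
  assumes "n \<ge> 1"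
  shows "(v, w) \<in> sim_h n \<longleftrightarrow> v \<in> W n \<and> w \<in> W n \<and> config n v = config n w"
proof -
  have "config n v = config n w" if "equivclp (horizontal_cover n) v w" for v w
    using that by induction (auto dest: horizontal_cover_config[OF _ assms])
  then show ?thesis using sim_h_if_config_eq[OF _ _ assms] by (auto simp: sim_h_def)
qed

section \<open>Vertical covers\<close>

text \<open>
  If the two ends have the same deletion, the cover must involve \<open>\<plusminus>n\<close>. Since \<open>-n\<close> is the least and
  \<open>n\<close> the greatest letter, only three kinds of such covers exist, one for each rule of
  \<open>config_step\<close>.
\<close>

lemma vertical_cover_config_step:
  assumes "vertical_cover n v w" "n \<ge> 1"
  shows "config_step n (config n v) (config n w)"
proof -
  have W: "v \<in> W n" "w \<in> W n" and cs: "cover_step v w" and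
    eq: "delete_letter n v = delete_letter n w"
    using assms by (auto simp: vertical_cover_def weak_cover_def)
  from cs show ?thesis
  proof cases
    case (swap a b x y)
    have le: "\<bar>a\<bar> \<le> int n" "\<bar>b\<bar> \<le> int n" using W swap by (auto simp: W_def)
    have "\<bar>a\<bar> = int n \<or> \<bar>b\<bar> = int n"
      using eq swap by (auto simp: delete_letter_def split: if_splits)
    moreover have "\<bar>a\<bar> \<noteq> \<bar>b\<bar>" using W swap by (auto simp: W_def)
    ultimately consider "a = - int n" | "b = int n" using le swap(3) by linarith
    then show ?thesis
    proof cases
      case 1
      have v: "x @ a # b # y \<in> W n" and w: "(x @ [b]) @ a # y \<in> W n" using W swap by auto
      have "config n v = (- int n, insert b (set y))"
        using W_config_split[OF v] swap 1 by simp
      moreover have "config n w = (- int n, set y)"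
        using W_config_split[OF w] swap 1 by simp
      moreover have "set y \<in> signed_subsets (n - 1)" "insert b (set y) \<in> signed_subsets (n - 1)"
        using signed_subset_suffix[OF v] signed_subset_suffix[OF w] 1 by auto
      moreover have "b \<notin> set y" using W_distinct[OF v] by simp
      moreover have "- b \<notin> set y" "\<bar>b\<bar> \<in> {1..int (n - 1)}"
        using \<open>insert b (set y) \<in> signed_subsets (n - 1)\<close> by (auto simp: signed_subsets_def)
      ultimately show ?thesis by (simp add: pass_down)
    next
      case 2
      have w: "x @ b # a # y \<in> W n" and v: "(x @ [a]) @ b # y \<in> W n" using W swap by auto
      have "config n w = (int n, insert a (set y))"
        using W_config_split[OF w] swap 2 by simp
      moreover have "config n v = (int n, set y)"
        using W_config_split[OF v] swap 2 by simp
      moreover have "set y \<in> signed_subsets (n - 1)" "insert a (set y) \<in> signed_subsets (n - 1)"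
        using signed_subset_suffix[OF v] signed_subset_suffix[OF w] 2 by auto
      moreover have "a \<notin> set y" using W_distinct[OF w] by simp
      moreover have "- a \<notin> set y" "\<bar>a\<bar> \<in> {1..int (n - 1)}"
        using \<open>insert a (set y) \<in> signed_subsets (n - 1)\<close> by (auto simp: signed_subsets_def)
      ultimately show ?thesis by (simp add: pass_up)
    qed
  next
    case (flip a y)
    have "\<bar>a\<bar> = int n" using eq flip by (auto simp: delete_letter_def split: if_splits)
    then have a: "a = int n" using flip by simp
    have v: "[] @ a # y \<in> W n" and w: "[] @ (- a) # y \<in> W n" using W flip by auto
    have "config n v = (int n, set y)" using W_config_split[OF v] flip a by simp
    moreover have "config n w = (- int n, set y)" using W_config_split[OF w] flip a by simp
    moreover have "set y \<in> signed_subsets (n - 1)" using signed_subset_suffix[OF v] a by simp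
    moreover have "abs ` set y = {1..int n} - {int n}" using v a by (auto simp: W_def image_iff)
    then have "abs ` set y = {1..int (n - 1)}" by auto
    ultimately show ?thesis by (simp add: turn)
  qed
qed

text \<open>
  The absolute values missing from a suffix can be put in front in any way, here increasingly and
  with positive signs.
\<close>

lemma W_completion:
  assumes "distinct (map abs v)" "abs ` set v \<subseteq> {1..int (n - 1)}" "\<bar>e\<bar> = int n" "n \<ge> 1"
  obtains u where "u @ e # v \<in> W n" 
proof -
  define u where "u = sorted_list_of_set ({1..int (n - 1)} - abs ` set v)"
  have u: "distinct u" "set u = {1..int (n - 1)} - abs ` set v" by (auto simp: u_def)
  have "map abs u = u" using u by (intro map_idI) auto
  then have "distinct (map abs u)" "abs ` set u = {1..int (n - 1)} - abs ` set v"
    using u by (simp_all flip: set_map)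
  moreover have "insert (int n) {1..int (n - 1)} = {1..int n}" using assms(4) by auto
  moreover have "int n \<notin> {1..int (n - 1)}" using assms(4) by auto
  ultimately have "u @ e # v \<in> W n" using assms by (auto simp: W_def)
  then show ?thesis by (rule that)
qed

lemma signed_subset_list:
  assumes "S \<in> signed_subsets m"
  obtains v where "set v = S" "distinct (map abs v)" "abs ` set v \<subseteq> {1..int m}"
proof -
  have "S \<subseteq> {- int m..int m}" using assms by (force simp: signed_subsets_def)
  then have "finite S" by (rule finite_subset) simp
  moreover have "inj_on abs S" using assms by (auto simp: signed_subsets_def inj_on_def abs_if split: if_splits)
  ultimately show ?thesis using assms that[of "sorted_list_of_set S"]
    by (simp add: distinct_map signed_subsets_def)
qed

lemma config_surj:
  assumes "p \<in> configs n" "n \<ge> 1"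
  obtains w where "w \<in> W n" "config n w = p"
proof -
  obtain e S where p: "p = (e, S)" "\<bar>e\<bar> = int n" "S \<in> signed_subsets (n - 1)"
    using assms by (auto simp: configs_def)
  obtain v where v: "set v = S" "distinct (map abs v)" "abs ` set v \<subseteq> {1..int (n - 1)}"
    using signed_subset_list[OF p(3)] .
  obtain u where "u @ e # v \<in> W n" using W_completion[OF v(2,3) p(2) assms(2)] .
  then show ?thesis using that W_config_split p v by simp
qed

text \<open>
  Since a class contains all arrangements of its prefix and suffix, there is a representative in
  which the letter to be exchanged stands next to \<open>\<plusminus>n\<close>.
\<close>

lemma config_step_lift:
  assumes "config_step n p q" "n \<ge> 1"
  obtains v w where "vertical_cover n v w" "config n v = p" "config n w = q"
  using assms(1)
proof cases
  case (pass_up S c)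
  obtain z where z: "set z = S" "distinct (map abs z)" "abs ` set z \<subseteq> {1..int (n - 1)}"
    using signed_subset_list[OF pass_up(3)] .
  have "distinct (map abs (c # z))"
    using z pass_up by (auto simp: abs_eq_iff)
  then obtain u where w: "u @ int n # c # z \<in> W n"
    using W_completion[of "c # z" n "int n"] z pass_up assms(2) by auto
  then have v: "(u @ [c]) @ int n # z \<in> W n" by (rule W_cong) simp
  have "cover_step ((u @ [c]) @ int n # z) (u @ int n # c # z)"
    using cover_step.swap[of c "int n" u z] pass_up by auto
  then have "vertical_cover n ((u @ [c]) @ int n # z) (u @ int n # c # z)"
    using v w by (simp add: vertical_cover_def weak_cover_def delete_letter_def)
  then show ?thesis using that W_config_split[OF v] W_config_split[OF w] z pass_up by simp
next
  case (turn S)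
  obtain z where z: "set z = S" "distinct (map abs z)" "abs ` set z \<subseteq> {1..int (n - 1)}"
    using signed_subset_list[OF turn(3)] .
  obtain u where v': "u @ int n # z \<in> W n"
    using W_completion[OF z(2,3), of "int n"] assms(2) by auto
  have "u = []"
  proof (cases u)
    case (Cons a u')
    then have "\<bar>a\<bar> \<in> abs ` set z" using W_abs_less[OF v', of a] turn z by simp
    then show ?thesis using v' Cons by (auto simp: W_def)
  qed
  then have v: "[] @ int n # z \<in> W n" using v' by simp
  then have w: "[] @ (- int n) # z \<in> W n" by (rule W_cong) simp
  have "cover_step (int n # z) (- int n # z)" using assms(2) by (intro cover_step.flip) simp
  then have "vertical_cover n (int n # z) (- int n # z)"
    using v w by (simp add: vertical_cover_def weak_cover_def delete_letter_def)
  then show ?thesis using that W_config_split[OF v] W_config_split[OF w] z turn by simp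
next
  case (pass_down S c)
  obtain z where z: "set z = S" "distinct (map abs z)" "abs ` set z \<subseteq> {1..int (n - 1)}"
    using signed_subset_list[OF pass_down(3)] .
  have "distinct (map abs (c # z))"
    using z pass_down by (auto simp: abs_eq_iff)
  then obtain u where v: "u @ (- int n) # c # z \<in> W n"
    using W_completion[of "c # z" n "- int n"] z pass_down assms(2) by auto
  then have w: "(u @ [c]) @ (- int n) # z \<in> W n" by (rule W_cong) simp
  have "cover_step (u @ (- int n) # c # z) ((u @ [c]) @ (- int n) # z)"
    using cover_step.swap[of "- int n" c u z] pass_down by auto
  then have "vertical_cover n (u @ (- int n) # c # z) ((u @ [c]) @ (- int n) # z)"
    using v w by (simp add: vertical_cover_def weak_cover_def delete_letter_def)
  then show ?thesis using that W_config_split[OF v] W_config_split[OF w] z pass_down by simp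
qed

section \<open>Configurations as acyclic orientations of the fan\<close>

text \<open>
  The vertex named by the letter \<open>e = \<plusminus>n\<close>: \<open>VR\<close> for \<open>n\<close> and \<open>VL\<close> for \<open>-n\<close>. In the doubled word \<open>e\<close>
  comes after \<open>-e\<close>, hence the name.
\<close>

definition top_vertex :: "int \<Rightarrow> fan_vertex" where
  "top_vertex e = (if e > 0 then VR else VL)"

text \<open>
  For a word \<open>u e v\<close>, the doubled word has the shape \<open>v' (-e) u' u e v\<close>, where \<open>u'\<close> and \<open>v'\<close> are the
  negated reversals of \<open>u\<close> and \<open>v\<close>. So \<open>e\<close> precedes \<open>i\<close> iff \<open>i\<close> lies in \<open>v\<close>, and \<open>i\<close> precedes \<open>-e\<close>
  iff \<open>-i\<close> lies in \<open>v\<close>. With \<open>S\<close> the set of letters of \<open>v\<close>, the arcs below thus point from the earlier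
  to the later letter, without reference to the word.
\<close>

definition orient :: "nat \<Rightarrow> int \<times> int set \<Rightarrow> fan_vertex rel" where
  "orient n p = (case p of (e, S) \<Rightarrow>
     let t = top_vertex e; b = top_vertex (- e); I = {1..n - 1} in
     {(b, t)}
     \<union> {(t, Mid i) |i. i \<in> I \<and> int i \<in> S} \<union> {(Mid i, t) |i. i \<in> I \<and> int i \<notin> S}
     \<union> {(Mid i, b) |i. i \<in> I \<and> - int i \<in> S} \<union> {(b, Mid i) |i. i \<in> I \<and> - int i \<notin> S})"

lemma orient_iff:
  assumes "e \<noteq> 0"
  shows "(VL, VR) \<in> orient n (e, S) \<longleftrightarrow> e > 0"
    "(VR, VL) \<in> orient n (e, S) \<longleftrightarrow> e < 0"
    "(VL, VL) \<notin> orient n (e, S)" "(VR, VR) \<notin> orient n (e, S)"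
    "(Mid i, Mid j) \<notin> orient n (e, S)"
    "(VR, Mid i) \<in> orient n (e, S) \<longleftrightarrow> i \<in> {1..n - 1} \<and> (if e > 0 then int i \<in> S else - int i \<notin> S)"
    "(Mid i, VR) \<in> orient n (e, S) \<longleftrightarrow> i \<in> {1..n - 1} \<and> (if e > 0 then int i \<notin> S else - int i \<in> S)"
    "(VL, Mid i) \<in> orient n (e, S) \<longleftrightarrow> i \<in> {1..n - 1} \<and> (if e > 0 then - int i \<notin> S else int i \<in> S)"
    "(Mid i, VL) \<in> orient n (e, S) \<longleftrightarrow> i \<in> {1..n - 1} \<and> (if e > 0 then - int i \<in> S else int i \<notin> S)"
  using assms by (auto simp: orient_def top_vertex_def)

lemma letter_cases:
  assumes "\<bar>c\<bar> \<in> {1..int m}"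
  obtains i where "i \<in> {1..m}" "c = int i" | i where "i \<in> {1..m}" "c = - int i"
  using assms by (cases c rule: int_cases2) auto

lemma signed_subset_eqI:
  assumes "abs ` S \<subseteq> {1..int m}" "abs ` S' \<subseteq> {1..int m}"
    and "\<And>i. i \<in> {1..m} \<Longrightarrow> (int i \<in> S \<longleftrightarrow> int i \<in> S') \<and> (- int i \<in> S \<longleftrightarrow> - int i \<in> S')"
  shows "S = S'"
proof -
  have "c \<in> S \<longleftrightarrow> c \<in> S'" if "\<bar>c\<bar> \<in> {1..int m}" for c
    using letter_cases[OF that] assms(3) by metis
  moreover have "\<bar>c\<bar> \<in> {1..int m}" if "c \<in> S \<union> S'" for c
    using that assms(1,2) by auto
  ultimately show ?thesis by blast
qed

text \<open>
  The set \<open>S\<close> can be read off the orientation.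
\<close>

lemma letter_mem_iff_arc:
  assumes "e \<noteq> 0" "i \<in> {1..n - 1}"
  shows "int i \<in> S \<longleftrightarrow> (if e > 0 then (VR, Mid i) else (VL, Mid i)) \<in> orient n (e, S)"
    "- int i \<in> S \<longleftrightarrow> (if e > 0 then (Mid i, VL) else (Mid i, VR)) \<in> orient n (e, S)"
  using assms by (simp_all add: orient_iff)

lemma fan_edge_iff:
  "{x, y} \<in> snd (fan_graph n) \<longleftrightarrow>
    (case (x, y) of (VL, VR) \<Rightarrow> True | (VR, VL) \<Rightarrow> True
     | (VL, Mid i) \<Rightarrow> i \<in> {1..n - 1} | (Mid i, VL) \<Rightarrow> i \<in> {1..n - 1}
     | (VR, Mid i) \<Rightarrow> i \<in> {1..n - 1} | (Mid i, VR) \<Rightarrow> i \<in> {1..n - 1} | _ \<Rightarrow> False)"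
  by (cases x; cases y) (auto simp: fan_graph_def doubleton_eq_iff)

lemma orient_orientation:
  assumes "e \<noteq> 0"
  shows "orient n (e, S) \<in> orientations (fan_graph n)"
proof -
  have "(x, y) \<in> fst (fan_graph n) \<times> fst (fan_graph n) \<and> {x, y} \<in> snd (fan_graph n)"
    if "(x, y) \<in> orient n (e, S)" for x y
    using that assms unfolding fan_edge_iff
    by (cases x; cases y) (auto simp: orient_iff fan_graph_def)
  moreover have "(x, y) \<in> orient n (e, S) \<longleftrightarrow> (y, x) \<notin> orient n (e, S)"
    if "{x, y} \<in> snd (fan_graph n)" for x y
    using that assms unfolding fan_edge_iff
    by (cases x; cases y) (auto simp: orient_iff)
  ultimately show ?thesis unfolding orientations_def mem_Collect_eq by (intro conjI) auto
qed

text \<open>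
  The level of a vertex is the block of the doubled word \<open>v' (-e) u' u e v\<close> in which its letter lies,
  with \<open>u' u\<close> counted as a single block. Arcs join letters of different blocks and point from left
  to right.
\<close>

lemma orient_acyclic:
  assumes "e \<noteq> 0" "\<forall>c\<in>S. - c \<notin> S"
  shows "acyclic (orient n (e, S))"
proof -
  define level :: "fan_vertex \<Rightarrow> int" where
    "level x = (case x of
        Mid i \<Rightarrow> if int i \<in> S then 4 else if - int i \<in> S then 0 else 2
      | _ \<Rightarrow> if x = top_vertex e then 3 else 1)" for x
  have "level x < level y" if "(x, y) \<in> orient n (e, S)" for x y
    using that assms by (auto simp: orient_def level_def top_vertex_def split: if_splits)
  then have "(-level y) < (-level x)" if "(x, y) \<in> orient n (e, S)" for x y
    using that by force
  then show ?thesis by (rule acyclicI_order[where f = "\<lambda>x. - level x"])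
qed

lemma orientation_maximal:
  assumes "A \<in> orientations G" "B \<in> orientations G" "A \<subseteq> B"
  shows "A = B"
  using assms unfolding orientations_def by blast

lemma orient_in_AO:
  assumes "p \<in> configs n" "n \<ge> 1"
  shows "orient n p \<in> AO (fan_graph n)"
  using assms orient_orientation orient_acyclic
  by (auto simp: configs_def AO_def signed_subsets_def)

lemma orient_inj:
  assumes "n \<ge> 1"
  shows "inj_on (orient n) (configs n)"
proof (rule inj_onI, clarify)
  fix e S e' S'
  assume c: "(e, S) \<in> configs n" "(e', S') \<in> configs n"
    and eq: "orient n (e, S) = orient n (e', S')"
  have nz: "e \<noteq> 0" "e' \<noteq> 0" using c assms by (auto simp: configs_def)
  have "e > 0 \<longleftrightarrow> e' > 0" using eq nz orient_iff(1) by metis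
  then have e: "e = e'" using c nz by (auto simp: configs_def)
  have "(int i \<in> S \<longleftrightarrow> int i \<in> S') \<and> (- int i \<in> S \<longleftrightarrow> - int i \<in> S')"
    if "i \<in> {1..n - 1}" for i
    using letter_mem_iff_arc[OF nz(1) that, of S] letter_mem_iff_arc[OF nz(1) that, of S'] eq e
    by simp
  then have "S = S'"
    using c by (intro signed_subset_eqI[of S "n - 1" S']) (auto simp: configs_def signed_subsets_def)
  then show "e = e' \<and> S = S'" using e by simp
qed

text \<open>
  For an acyclic orientation, let \<open>t\<close> be the head and \<open>b\<close> the tail of the arc between \<open>VL\<close> and \<open>VR\<close>.
  The path \<open>t \<rightarrow> Mid i \<rightarrow> b\<close> is excluded, since it would close a cycle; this is the requirement
  that \<open>S\<close> does not contain both \<open>i\<close> and \<open>-i\<close>.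
\<close>

lemma orient_surj:
  assumes "A \<in> AO (fan_graph n)" "n \<ge> 1"
  obtains p where "p \<in> configs n" "orient n p = A"
proof -
  define e where "e = (if (VL, VR) \<in> A then int n else - int n)"
  define t where "t = top_vertex e"
  define b where "b = top_vertex (- e)"
  define S where "S = {int i |i. i \<in> {1..n - 1} \<and> (t, Mid i) \<in> A}
    \<union> {- int i |i. i \<in> {1..n - 1} \<and> (Mid i, b) \<in> A}"
  have A: "A \<in> orientations (fan_graph n)" "acyclic A" using assms by (auto simp: AO_def)
  have edge: "(x, y) \<in> A \<longleftrightarrow> (y, x) \<notin> A" if "{x, y} \<in> snd (fan_graph n)" for x y
    using A(1) that unfolding orientations_def by blast
  have e: "\<bar>e\<bar> = int n" "e \<noteq> 0" using assms(2) by (auto simp: e_def)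
  have tb: "t = VR \<and> b = VL \<or> t = VL \<and> b = VR" using e by (auto simp: t_def b_def top_vertex_def)
  have bt: "(b, t) \<in> A"
    using edge[of VL VR] assms(2) by (auto simp: fan_edge_iff t_def b_def top_vertex_def e_def)
  have mid: "(t, Mid i) \<in> A \<longleftrightarrow> (Mid i, t) \<notin> A" "(Mid i, b) \<in> A \<longleftrightarrow> (b, Mid i) \<notin> A"
    if "i \<in> {1..n - 1}" for i
    using that edge[of t "Mid i"] edge[of "Mid i" b] tb by (auto simp: fan_edge_iff)
  have no: "\<not> ((t, Mid i) \<in> A \<and> (Mid i, b) \<in> A)" for i
  proof
    assume "(t, Mid i) \<in> A \<and> (Mid i, b) \<in> A"
    then have "(t, t) \<in> A\<^sup>+" using bt by (meson trancl.intros)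
    then show False using A(2) by (simp add: acyclic_def)
  qed
  have pos: "int i \<in> S \<longleftrightarrow> (t, Mid i) \<in> A" and neg: "- int i \<in> S \<longleftrightarrow> (Mid i, b) \<in> A"
    if "i \<in> {1..n - 1}" for i using that by (auto simp: S_def)
  have "orient n (e, S) \<subseteq> A"
    using bt mid pos neg by (auto simp: orient_def Let_def simp flip: t_def b_def)
  then have "orient n (e, S) = A" using orientation_maximal orient_orientation A(1) e by blast
  moreover have "S \<in> signed_subsets (n - 1)"
    using no by (force simp: S_def signed_subsets_def)
  ultimately show ?thesis using that e by (auto simp: configs_def)
qed

lemma orient_bij:
  assumes "n \<ge> 1"
  shows "bij_betw (orient n) (configs n) (AO (fan_graph n))"
  using orient_inj[OF assms] orient_in_AO orient_surj assms
  by (auto simp: bij_betw_def) (metis image_eqI)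

section \<open>Steps of configurations as arc reversals\<close>

definition fan_flip :: "nat \<Rightarrow> fan_vertex rel \<Rightarrow> fan_vertex rel \<Rightarrow> bool" where
  "fan_flip n A B \<longleftrightarrow>
    (\<exists>x y. (x, y) \<in> A \<and> (x, y) \<in> fan_base n \<and> B = insert (y, x) (A - {(x, y)}))"

lemma fan_rel_eqI:
  fixes A B :: "fan_vertex rel"
  assumes "(VL, VL) \<in> A \<longleftrightarrow> (VL, VL) \<in> B" "(VR, VR) \<in> A \<longleftrightarrow> (VR, VR) \<in> B"
    "(VL, VR) \<in> A \<longleftrightarrow> (VL, VR) \<in> B" "(VR, VL) \<in> A \<longleftrightarrow> (VR, VL) \<in> B"
    "\<And>i. (VL, Mid i) \<in> A \<longleftrightarrow> (VL, Mid i) \<in> B" "\<And>i. (Mid i, VL) \<in> A \<longleftrightarrow> (Mid i, VL) \<in> B"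
    "\<And>i. (VR, Mid i) \<in> A \<longleftrightarrow> (VR, Mid i) \<in> B" "\<And>i. (Mid i, VR) \<in> A \<longleftrightarrow> (Mid i, VR) \<in> B"
    "\<And>i j. (Mid i, Mid j) \<in> A \<longleftrightarrow> (Mid i, Mid j) \<in> B"
  shows "A = B"
proof -
  have "(x, y) \<in> A \<longleftrightarrow> (x, y) \<in> B" for x y
    using assms by (cases x; cases y) auto
  then show ?thesis by auto
qed

text \<open>
  Adding \<open>i\<close> to \<open>S\<close> behind \<open>n\<close>, or removing \<open>-i\<close> from \<open>S\<close> behind \<open>-n\<close>, reverses \<open>Mid i \<rightarrow> VR\<close>;
  adding \<open>-i\<close> behind \<open>n\<close>, or removing \<open>i\<close> behind \<open>-n\<close>, reverses \<open>VL \<rightarrow> Mid i\<close>. Turning \<open>n\<close> into \<open>-n\<close>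
  exchanges the roles of \<open>VL\<close> and \<open>VR\<close> in \<open>orient\<close>. All arcs at \<open>Mid i\<close> survive this exchange exactly
  if one of \<open>i\<close> and \<open>-i\<close> lies in \<open>S\<close>.
\<close>

lemma config_step_fan_flip:
  assumes "config_step n p q" "n \<ge> 1"
  shows "fan_flip n (orient n p) (orient n q)"
  using assms(1)
proof cases
  case (pass_up S c)
  from pass_up(4) show ?thesis
  proof (cases rule: letter_cases)
    case (1 i)
    show ?thesis unfolding fan_flip_def
    proof (intro exI conjI)
      show "(Mid i, VR) \<in> orient n p" "(Mid i, VR) \<in> fan_base n"
        using 1 pass_up assms(2) by (auto simp: orient_iff fan_base_def)
      show "orient n q = insert (VR, Mid i) (orient n p - {(Mid i, VR)})"
        by (rule fan_rel_eqI) (use 1 pass_up assms(2) in \<open>auto simp: orient_iff\<close>)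
    qed
  next
    case (2 i)
    show ?thesis unfolding fan_flip_def
    proof (intro exI conjI)
      show "(VL, Mid i) \<in> orient n p" "(VL, Mid i) \<in> fan_base n"
        using 2 pass_up assms(2) by (auto simp: orient_iff fan_base_def)
      show "orient n q = insert (Mid i, VL) (orient n p - {(VL, Mid i)})"
        by (rule fan_rel_eqI) (use 2 pass_up assms(2) in \<open>auto simp: orient_iff\<close>)
    qed
  qed
next
  case (turn S)
  have full: "int i \<in> S \<longleftrightarrow> - int i \<notin> S" if "i \<in> {1..n - 1}" for i
  proof -
    have "int i \<in> abs ` S" using that turn(4) by auto
    then have "int i \<in> S \<or> - int i \<in> S" by (auto simp: abs_if)
    then show ?thesis using turn(3) by (auto simp: signed_subsets_def)
  qed
  show ?thesis unfolding fan_flip_def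
  proof (intro exI conjI)
    show "(VL, VR) \<in> orient n p" "(VL, VR) \<in> fan_base n"
      using turn assms(2) by (auto simp: orient_iff fan_base_def)
    show "orient n q = insert (VR, VL) (orient n p - {(VL, VR)})"
      by (rule fan_rel_eqI) (use turn(1,2) full assms(2) in \<open>auto simp: orient_iff\<close>)
  qed
next
  case (pass_down S c)
  from pass_down(4) show ?thesis
  proof (cases rule: letter_cases)
    case (1 i)
    show ?thesis unfolding fan_flip_def
    proof (intro exI conjI)
      show "(VL, Mid i) \<in> orient n p" "(VL, Mid i) \<in> fan_base n"
        using 1 pass_down assms(2) by (auto simp: orient_iff fan_base_def)
      show "orient n q = insert (Mid i, VL) (orient n p - {(VL, Mid i)})"
        by (rule fan_rel_eqI) (use 1 pass_down assms(2) in \<open>auto simp: orient_iff\<close>)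
    qed
  next
    case (2 i)
    show ?thesis unfolding fan_flip_def
    proof (intro exI conjI)
      show "(Mid i, VR) \<in> orient n p" "(Mid i, VR) \<in> fan_base n"
        using 2 pass_down assms(2) by (auto simp: orient_iff fan_base_def)
      show "orient n q = insert (VR, Mid i) (orient n p - {(Mid i, VR)})"
        by (rule fan_rel_eqI) (use 2 pass_down assms(2) in \<open>auto simp: orient_iff\<close>)
    qed
  qed
qed

text \<open>
  The reversed base arc determines the kind of step. Both \<open>S\<close> and \<open>S'\<close> can be read off the two
  orientations, which differ in this arc only, and the condition that neither \<open>S\<close> nor \<open>S'\<close> contains
  a letter together with its negative yields the side conditions of the step.
\<close>

lemma fan_flip_config_step:
  assumes "fan_flip n (orient n p) (orient n q)" "p \<in> configs n" "q \<in> configs n" "n \<ge> 1"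
  shows "config_step n p q"
proof -
  obtain e S e' S' where pq: "p = (e, S)" "q = (e', S')" by fastforce
  have e: "\<bar>e\<bar> = int n" "\<bar>e'\<bar> = int n" "e \<noteq> 0" "e' \<noteq> 0"
    and S: "S \<in> signed_subsets (n - 1)" "S' \<in> signed_subsets (n - 1)"
    using assms by (auto simp: configs_def pq)
  obtain x y where xy: "(x, y) \<in> orient n p" "(x, y) \<in> fan_base n"
    and q: "orient n q = insert (y, x) (orient n p - {(x, y)})"
    using assms(1) by (auto simp: fan_flip_def)
  have q_arc: "a \<in> orient n q \<longleftrightarrow> a = (y, x) \<or> a \<in> orient n p \<and> a \<noteq> (x, y)" for a
    using q by auto
  note p_iff = orient_iff[OF e(3), where n = n and S = S, folded pq]
  note q_iff = orient_iff[OF e(4), where n = n and S = S', folded pq]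
  have opp: "- c \<notin> S" if "c \<in> S" for c using S that by (auto simp: signed_subsets_def)
  have opp': "- c \<notin> S'" if "c \<in> S'" for c using S that by (auto simp: signed_subsets_def)
  note p_mem = letter_mem_iff_arc[OF e(3), where n = n and S = S, folded pq]
  note q_mem = letter_mem_iff_arc[OF e(4), where n = n and S = S', folded pq]
  from xy(2) consider "x = VL" "y = VR"
    | i where "i \<in> {1..n - 1}" "x = VL" "y = Mid i" | i where "i \<in> {1..n - 1}" "x = Mid i" "y = VR"
    by (auto simp: fan_base_def)
  then show ?thesis
  proof cases
    case 1
    have "e > 0" using xy(1) 1 p_iff by simp
    have "(VR, VL) \<in> orient n q" using 1 by (simp add: q_arc)
    then have "e' < 0" using q_iff by simp
    \<comment> \<open>reversing the arc exchanges the two readings of the arcs at \<open>Mid i\<close>\<close>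
    have swap: "(int i \<in> S \<longleftrightarrow> - int i \<notin> S') \<and> (- int i \<in> S \<longleftrightarrow> int i \<notin> S')"
      if "i \<in> {1..n - 1}" for i
      using \<open>e > 0\<close> \<open>e' < 0\<close> 1 that
      by (simp add: p_mem[OF that] q_mem[OF that] q_arc) (auto simp: p_iff)
    then have "S = S'" using opp opp' S
      by (intro signed_subset_eqI[of S "n - 1" S']) (auto simp: signed_subsets_def)
    moreover have "abs ` S = {1..int (n - 1)}"
    proof
      show "abs ` S \<subseteq> {1..int (n - 1)}" using S by (simp add: signed_subsets_def)
      show "{1..int (n - 1)} \<subseteq> abs ` S"
      proof
        fix c assume "c \<in> {1..int (n - 1)}"
        then obtain i where i: "i \<in> {1..n - 1}" "c = int i"
          by (metis atLeastAtMost_iff nonneg_int_cases of_nat_1 of_nat_le_iff zero_le_one order_trans)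
        then have "int i \<in> S \<or> - int i \<in> S" using swap \<open>S = S'\<close> by blast
        then show "c \<in> abs ` S" using i by force
      qed
    qed
    moreover have "e = int n" "e' = - int n" using e \<open>e > 0\<close> \<open>e' < 0\<close> by auto
    ultimately show ?thesis using S pq by (simp add: turn)
  next
    case (2 i)
    then have "(VL, VR) \<in> orient n p \<longleftrightarrow> (VL, VR) \<in> orient n q" by (simp add: q_arc)
    then have same: "e = e'" using p_iff(1) q_iff(1) e by auto
    show ?thesis
    proof (cases "e > 0")
      case e_sign: True
      have mem: "(int j \<in> S' \<longleftrightarrow> int j \<in> insert (- int i) S) \<and> (- int j \<in> S' \<longleftrightarrow> - int j \<in> insert (- int i) S)"
        if "j \<in> {1..n - 1}" for j
        using e_sign same xy(1) 2 by (auto simp: p_mem[OF that] q_mem[OF that] q_arc)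
      have new: "- int i \<in> S'" "- int i \<notin> S"
        using e_sign same 2 xy(1) by (simp_all add: q_mem q_arc p_iff)
      have "S' = insert (- int i) S"
        using S mem 2(1) by (intro signed_subset_eqI[of _ "n - 1"]) (auto simp: signed_subsets_def)
      moreover have "- (- int i) \<notin> S" using opp'[OF new(1)] calculation by auto
      moreover have "e = int n" "e' = int n" "\<bar>- int i\<bar> \<in> {1..int (n - 1)}" using e e_sign same 2 by auto
      ultimately show ?thesis using pass_up[of S n "- int i"] S new pq by simp
    next
      case e_sign: False
      have mem: "(int j \<in> S \<longleftrightarrow> int j \<in> insert (int i) S') \<and> (- int j \<in> S \<longleftrightarrow> - int j \<in> insert (int i) S')"
        if "j \<in> {1..n - 1}" for j
        using e_sign same xy(1) 2 by (auto simp: p_mem[OF that] q_mem[OF that] q_arc)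
      have new: "int i \<in> S" "int i \<notin> S'"
        using e_sign same 2 xy(1) by (simp_all add: q_mem q_arc p_iff)
      have "S = insert (int i) S'"
        using S mem 2(1) by (intro signed_subset_eqI[of _ "n - 1"]) (auto simp: signed_subsets_def)
      moreover have "- (int i) \<notin> S'" using opp[OF new(1)] calculation by auto
      moreover have "e = - int n" "e' = - int n" "\<bar>int i\<bar> \<in> {1..int (n - 1)}" using e e_sign same 2 by auto
      ultimately show ?thesis using pass_down[of S' n "int i"] S new pq by simp
    qed
  next
    case (3 i)
    then have "(VL, VR) \<in> orient n p \<longleftrightarrow> (VL, VR) \<in> orient n q" by (simp add: q_arc)
    then have same: "e = e'" using p_iff(1) q_iff(1) e by auto
    show ?thesis
    proof (cases "e > 0")
      case e_sign: True
      have mem: "(int j \<in> S' \<longleftrightarrow> int j \<in> insert (int i) S) \<and> (- int j \<in> S' \<longleftrightarrow> - int j \<in> insert (int i) S)"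
        if "j \<in> {1..n - 1}" for j
        using e_sign same xy(1) 3 by (auto simp: p_mem[OF that] q_mem[OF that] q_arc)
      have new: "int i \<in> S'" "int i \<notin> S"
        using e_sign same 3 xy(1) by (simp_all add: q_mem q_arc p_iff)
      have "S' = insert (int i) S"
        using S mem 3(1) by (intro signed_subset_eqI[of _ "n - 1"]) (auto simp: signed_subsets_def)
      moreover have "- (int i) \<notin> S" using opp'[OF new(1)] calculation by auto
      moreover have "e = int n" "e' = int n" "\<bar>int i\<bar> \<in> {1..int (n - 1)}" using e e_sign same 3 by auto
      ultimately show ?thesis using pass_up[of S n "int i"] S new pq by simp
    next
      case e_sign: False
      have mem: "(int j \<in> S \<longleftrightarrow> int j \<in> insert (- int i) S') \<and> (- int j \<in> S \<longleftrightarrow> - int j \<in> insert (- int i) S')"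
        if "j \<in> {1..n - 1}" for j
        using e_sign same xy(1) 3 by (auto simp: p_mem[OF that] q_mem[OF that] q_arc)
      have new: "- int i \<in> S" "- int i \<notin> S'"
        using e_sign same 3 xy(1) by (simp_all add: q_mem q_arc p_iff)
      have "S = insert (- int i) S'"
        using S mem 3(1) by (intro signed_subset_eqI[of _ "n - 1"]) (auto simp: signed_subsets_def)
      moreover have "- (- int i) \<notin> S'" using opp[OF new(1)] calculation by auto
      moreover have "e = - int n" "e' = - int n" "\<bar>- int i\<bar> \<in> {1..int (n - 1)}" using e e_sign same 3 by auto
      ultimately show ?thesis using pass_down[of S' n "- int i"] S new pq by simp
    qed
  qed
qed

section \<open>Digraphs of pairs\<close>

lemma digraph_iso_with_projI:
  assumes f: "bij_betw f (pverts G) (pverts H)"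
    and arcs: "parcs G \<subseteq> pverts G \<times> pverts G" "parcs H \<subseteq> pverts H \<times> pverts H"
    and iff: "\<And>x y. x \<in> pverts G \<Longrightarrow> y \<in> pverts G \<Longrightarrow> (x, y) \<in> parcs G \<longleftrightarrow> (f x, f y) \<in> parcs H"
  shows "digraph_iso (with_proj G) (with_proj H)"
proof -
  define h where "h = \<lparr>iso_verts = f, iso_arcs = map_prod f f, iso_head = snd, iso_tail = fst\<rparr>"
  have wf: "wf_digraph (with_proj G)" using arcs(1) by unfold_locales auto
  have inj: "inj_on (map_prod f f) (parcs G)"
    using map_prod_inj_on[OF bij_betw_imp_inj_on[OF f] bij_betw_imp_inj_on[OF f]] arcs(1)
    by (rule inj_on_subset)
  have "map_prod f f ` parcs G = parcs H"
  proof
    show "map_prod f f ` parcs G \<subseteq> parcs H" using iff arcs(1) by auto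
    show "parcs H \<subseteq> map_prod f f ` parcs G"
    proof
      fix a assume a: "a \<in> parcs H"
      then have "a \<in> map_prod f f ` (pverts G \<times> pverts G)"
        using arcs(2) f by (auto simp: bij_betw_def map_prod_surj_on)
      then show "a \<in> map_prod f f ` parcs G" using a iff by auto
    qed
  qed
  then have "with_proj H = app_iso h (with_proj G)"
    using f by (simp add: app_iso_def h_def with_proj_def bij_betw_def)
  moreover have "pre_digraph.digraph_isomorphism (with_proj G) h"
    using wf inj f by (auto simp: pre_digraph.digraph_isomorphism_def h_def bij_betw_def)
  ultimately show ?thesis unfolding digraph_iso_def by blast
qed

lemma partial_order_on_reachability:
  assumes "acyclic (arcs_ends G)"
  shows "partial_order_on (verts G) (reachability_rel G)"
proof -
  have "antisym ((arcs_ends G)\<^sup>*)" using assms by (rule acyclic_impl_antisym_rtrancl)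
  then have "antisym (reachability_rel G)"
    by (rule antisym_subset[rotated]) (auto simp: reachability_rel_def reachable_def dest: rtrancl_on_rtranclI)
  moreover have "trans (reachability_rel G)"
    by (rule transI) (auto simp: reachability_rel_def reachable_def intro: rtrancl_on_trans)
  ultimately show ?thesis
    by (auto simp: partial_order_on_def preorder_on_def refl_on_def reachability_rel_def
        reachable_def dest: in_rtrancl_on_in_F)
qed

section \<open>The pre-Reeb graph\<close>

definition class_config :: "nat \<Rightarrow> int list set \<Rightarrow> int \<times> int set" where
  "class_config n C = the_elem (config n ` C)"

lemma class_config_eq:
  assumes "C \<in> W n // sim_h n" "w \<in> C" "n \<ge> 1"
  shows "class_config n C = config n w"
proof -
  have "config n ` C = {config n w}"
    using assms(1,2) by (auto simp: quotient_def sim_h_iff_config[OF assms(3)])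
  then show ?thesis by (simp add: class_config_def)
qed

text \<open>
  Since the classes are the fibres of \<open>config\<close>, whether there is an arc between two classes depends
  only on their configurations.
\<close>

lemma class_eq:
  assumes "C \<in> W n // sim_h n" "n \<ge> 1"
  shows "C = {w \<in> W n. config n w = class_config n C}"
proof -
  obtain w where "C = sim_h n `` {w}" "w \<in> W n" using assms by (auto simp: quotient_def)
  then have C: "C = {v \<in> W n. config n v = config n w}" and "w \<in> C"
    by (auto simp: sim_h_iff_config[OF assms(2)])
  then show ?thesis using class_config_eq[OF assms(1) _ assms(2)] by metis
qed

lemma class_config_bij:
  assumes "n \<ge> 1"
  shows "bij_betw (class_config n) (W n // sim_h n) (configs n)"
  unfolding bij_betw_def
proof (intro conjI equalityI subsetI)
  show "inj_on (class_config n) (W n // sim_h n)"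
    using class_eq[OF _ assms] by (intro inj_onI) metis
next
  fix p assume "p \<in> class_config n ` (W n // sim_h n)"
  then obtain w where w: "w \<in> W n" "p = class_config n (sim_h n `` {w})"
    by (auto simp: quotient_def)
  then have "p = config n w"
    using class_config_eq[OF _ _ assms, of "sim_h n `` {w}" w]
    by (auto simp: quotient_def sim_h_iff_config[OF assms])
  then show "p \<in> configs n" using config_in_configs[OF w(1) assms] by simp
next
  fix p assume "p \<in> configs n"
  then obtain w where w: "w \<in> W n" "config n w = p" using config_surj assms by metis
  then have "sim_h n `` {w} \<in> W n // sim_h n" "w \<in> sim_h n `` {w}"
    by (auto simp: quotient_def sim_h_iff_config[OF assms])
  then show "p \<in> class_config n ` (W n // sim_h n)"
    using class_config_eq[OF _ _ assms] w(2) by (metis image_eqI)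
qed

lemma pre_Reeb_arc_iff_config_step:
  assumes "n \<ge> 1" "C \<in> W n // sim_h n" "D \<in> W n // sim_h n"
  shows "(C, D) \<in> parcs (pre_Reeb n) \<longleftrightarrow> config_step n (class_config n C) (class_config n D)"
proof
  assume "(C, D) \<in> parcs (pre_Reeb n)"
  then obtain v w where "v \<in> C" "w \<in> D" "vertical_cover n v w" by (auto simp: pre_Reeb_def)
  then show "config_step n (class_config n C) (class_config n D)"
    using vertical_cover_config_step class_config_eq assms by metis
next
  assume "config_step n (class_config n C) (class_config n D)"
  then obtain v w where vw: "vertical_cover n v w"
    "config n v = class_config n C" "config n w = class_config n D"
    using config_step_lift assms(1) by metis
  moreover have "v \<in> W n" "w \<in> W n" using vw(1) by (auto simp: vertical_cover_def weak_cover_def)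
  ultimately have "v \<in> C" "w \<in> D" using class_eq[OF _ assms(1)] assms(2,3) by blast+
  then show "(C, D) \<in> parcs (pre_Reeb n)" using vw(1) assms by (auto simp: pre_Reeb_def)
qed

text \<open>
  Since \<open>S\<close> has at most \<open>n - 1\<close> elements, \<open>2 n - card S\<close> exceeds every rank on the side of \<open>n\<close>.
\<close>

lemma config_step_rank:
  assumes "config_step n (e, S) (e', S')" "n \<ge> 1"
  defines "rank \<equiv> \<lambda>(e, S). if e > 0 then int (card S) else 2 * int n - int (card S)"
  shows "rank (e, S) < rank (e', S')"
proof -
  have fin: "finite T" "card T < n" if "T \<in> signed_subsets (n - 1)" for T
  proof -
    obtain v where v: "set v = T" "distinct (map abs v)" "abs ` set v \<subseteq> {1..int (n - 1)}"
      using signed_subset_list[OF \<open>T \<in> _\<close>] .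
    have "card T \<le> card (abs ` T)" using v by (metis card_length distinct_card length_map set_map)
    also have "\<dots> \<le> n - 1" using card_mono[OF _ v(3)] v(1) by simp
    finally show "finite T" "card T < n" using v(1) assms(2) by auto
  qed
  from assms(1) show ?thesis
    by cases (use fin assms(2) in \<open>auto simp: rank_def\<close>)
qed

lemma pre_Reeb_acyclic:
  assumes "n \<ge> 1"
  shows "acyclic (parcs (pre_Reeb n))"
proof -
  define rank where
    "rank = (\<lambda>(e :: int, S :: int set). if e > 0 then int (card S) else 2 * int n - int (card S))"
  have "rank (class_config n C) < rank (class_config n D)" if "(C, D) \<in> parcs (pre_Reeb n)" for C D
  proof -
    have "C \<in> W n // sim_h n" "D \<in> W n // sim_h n" using that by (auto simp: pre_Reeb_def)
    then have "config_step n (class_config n C) (class_config n D)"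
      using that pre_Reeb_arc_iff_config_step assms by blast
    then show ?thesis unfolding rank_def
      by (cases "class_config n C"; cases "class_config n D") (simp only: config_step_rank[OF _ assms])
  qed
  then show ?thesis by (intro acyclicI_order[where f = "\<lambda>C. - rank (class_config n C)"]) simp
qed

theorem proposition3p4:
  fixes n :: nat
  assumes "n \<ge> 1"
  shows "digraph_iso (with_proj (pre_Reeb n)) (with_proj (Gamma_fan n))
    \<and> acyclic (arcs_ends (with_proj (pre_Reeb n)))
    \<and> partial_order_on (verts (with_proj (pre_Reeb n)))
        (reachability_rel (with_proj (pre_Reeb n)))"
proof (intro conjI)
  let ?f = "orient n \<circ> class_config n"
  have Gamma: "pverts (Gamma_fan n) = AO (fan_graph n)"
    "(A, B) \<in> parcs (Gamma_fan n) \<longleftrightarrow> A \<in> AO (fan_graph n) \<and> B \<in> AO (fan_graph n) \<and> fan_flip n A B"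
    for A B by (auto simp: Gamma_fan_def AO_flip_graph_def fan_flip_def)
  show "digraph_iso (with_proj (pre_Reeb n)) (with_proj (Gamma_fan n))"
  proof (rule digraph_iso_with_projI)
    show "bij_betw ?f (pverts (pre_Reeb n)) (pverts (Gamma_fan n))"
      using bij_betw_trans[OF class_config_bij orient_bij] assms by (simp add: pre_Reeb_def Gamma)
    show "parcs (pre_Reeb n) \<subseteq> pverts (pre_Reeb n) \<times> pverts (pre_Reeb n)"
      by (auto simp: pre_Reeb_def)
    show "parcs (Gamma_fan n) \<subseteq> pverts (Gamma_fan n) \<times> pverts (Gamma_fan n)"
      by (auto simp: Gamma)
    fix C D assume "C \<in> pverts (pre_Reeb n)" "D \<in> pverts (pre_Reeb n)"
    then have CD: "C \<in> W n // sim_h n" "D \<in> W n // sim_h n" by (simp_all add: pre_Reeb_def)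
    then have conf: "class_config n C \<in> configs n" "class_config n D \<in> configs n"
      using class_config_bij[OF assms] by (auto simp: bij_betw_def)
    show "(C, D) \<in> parcs (pre_Reeb n) \<longleftrightarrow> (?f C, ?f D) \<in> parcs (Gamma_fan n)"
      unfolding pre_Reeb_arc_iff_config_step[OF assms CD] Gamma comp_def
      using conf assms orient_in_AO config_step_fan_flip fan_flip_config_step by blast
  qed
  show "acyclic (arcs_ends (with_proj (pre_Reeb n)))"
    using pre_Reeb_acyclic[OF assms] by simp
  then show "partial_order_on (verts (with_proj (pre_Reeb n)))
      (reachability_rel (with_proj (pre_Reeb n)))"
    by (rule partial_order_on_reachability)
qed

end
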